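(* Let $k,n$ be integers with $n\geqslant k+2\geqslant 4$, let $a_0,\ldots,a_k$ be non-zero integers each having all of its prime factors $\leqslant k$, and let $F_{n,k}(x)=\sum_{j=0}^k a_jc_jx^j$ where $c_j=(-1)^{k-j}\binom{n}{j}\binom{n-j-1}{k-j}$. Suppose there exist a prime $p>k$ and an integer $l$ with $1\leqslant l\leqslant k-1$ such that $p\mid(n-l)$, and let $e=\mathrm{ord}_p(n-l)$; suppose further that $\gcd(e,l)\leqslant 2$ and $\gcd(e,k-l)\leqslant 2$. If $l_1<k/2$ is a positive integer such that $l\notin\{l_1,2l_1,k-l_1,k-2l_1\}$, then $F_{n,k}(x)$ has no factor of degree $l_1$ over $\mathbb{Q}$.
   Context: $\mathrm{ord}_p(m)$ denotes the exponent of the highest power of the prime $p$ dividing the non-zero integer $m$. *)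

theory Defs
  imports Complex_Main "HOL-Computational_Algebra.Computational_Algebra"
begin

definition coeff_c :: "nat \<Rightarrow> nat \<Rightarrow> nat \<Rightarrow> int" where
  "coeff_c n k j = (- 1) ^ (k - j) * int (n choose j) * int ((n - j - 1) choose (k - j))"

definition poly_F :: "(nat \<Rightarrow> int) \<Rightarrow> nat \<Rightarrow> nat \<Rightarrow> int poly" where
  "poly_F a n k = (\<Sum>j\<le>k. monom (a j * coeff_c n k j) j)"

end

theory Submission
  imports Defs
begin

text \<open>Since \<open>p > k\<close>, among \<open>n, \<dots>, n - k\<close> only \<open>n - l\<close> is divisible by \<open>p\<close>, so all coefficients of
  \<open>F\<close> have \<open>p\<close>-adic order \<open>e\<close>, except that of \<open>x\<^sup>l\<close>, which is prime to \<open>p\<close>. The Newton polygon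
  therefore has just the vertices \<open>(0, e)\<close>, \<open>(l, 0)\<close>, \<open>(k, e)\<close>. By Dumas' theorem, here in the form
  that minimisers of a generic linear weight on the Newton diagram are additive under
  multiplication, a factor of degree \<open>l\<^sub>1\<close> yields \<open>l\<^sub>1 = t + r\<close> with
  \<open>l dvd e * t\<close> and \<open>k - l dvd e * r\<close>. The gcd conditions restrict \<open>t\<close> to \<open>0, l/2, l\<close> and \<open>r\<close> to
  \<open>0, (k - l)/2, k - l\<close>, and \<open>0 < l\<^sub>1 < k/2\<close> leaves only the excluded values.\<close>

section \<open>Newton polygons through linear weights\<close>

definition newton_weight :: "'a::factorial_semiring \<Rightarrow> int \<Rightarrow> int \<Rightarrow> 'a poly \<Rightarrow> nat \<Rightarrow> int" where
  "newton_weight p A B f i = A * int (multiplicity p (coeff f i)) + B * int i"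

text \<open>For \<open>A > 0\<close> this is the vertex of the Newton polygon of the points
  \<open>(i, multiplicity p (coeff f i))\<close> that the direction \<open>(B, A)\<close> exposes.
  Zero coefficients are excluded explicitly, since \<open>multiplicity p 0\<close> is 0 and not
  infinity.\<close>

definition newton_vertex :: "'a::factorial_semiring \<Rightarrow> int \<Rightarrow> int \<Rightarrow> 'a poly \<Rightarrow> nat \<Rightarrow> bool" where
  "newton_vertex p A B f s \<longleftrightarrow> coeff f s \<noteq> 0 \<and>
     (\<forall>i. i \<noteq> s \<longrightarrow> coeff f i \<noteq> 0 \<longrightarrow> newton_weight p A B f s < newton_weight p A B f i)"

lemma newton_vertex_unique:
  assumes "newton_vertex p A B f s" "newton_vertex p A B f t"
  shows "s = t"
  using assms unfolding newton_vertex_def by (metis less_asym)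

lemma newton_vertex_le:
  assumes "newton_vertex p A B f s" "coeff f i \<noteq> 0"
  shows "newton_weight p A B f s \<le> newton_weight p A B f i"
  using assms unfolding newton_vertex_def by (cases "i = s") (auto intro: less_imp_le)

lemma newton_vertex_le_degree: "newton_vertex p A B f s \<Longrightarrow> s \<le> degree f"
  by (simp add: newton_vertex_def le_degree)

text \<open>Coprimality of \<open>B\<close> to a large divisor of \<open>A\<close> keeps the weights of distinct indices distinct.\<close>

lemma newton_vertex_exists:
  fixes f :: "'a::factorial_semiring poly"
  assumes "f \<noteq> 0" "N dvd A" "coprime B N" "int (degree f) < N"
  obtains s where "newton_vertex p A B f s"
proof -
  let ?w = "newton_weight p A B f"
  let ?S = "{i. i \<le> degree f \<and> coeff f i \<noteq> 0}"
  have "finite ?S" "?S \<noteq> {}"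
    using \<open>f \<noteq> 0\<close> by auto
  then obtain s where s: "s \<in> ?S" "\<And>i. i \<in> ?S \<Longrightarrow> ?w s \<le> ?w i"
    using arg_min_if_finite[of ?S ?w] by (metis (no_types, lifting) linorder_not_less)
  have "?w s < ?w i" if "i \<noteq> s" "coeff f i \<noteq> 0" for i
  proof -
    have i: "i \<in> ?S"
      using that le_degree by blast
    have "?w s \<noteq> ?w i"
    proof
      assume "?w s = ?w i"
      then have "B * (int i - int s) = A * (int (multiplicity p (coeff f s)) - int (multiplicity p (coeff f i)))"
        by (simp add: newton_weight_def algebra_simps)
      then have "N dvd B * (int i - int s)"
        using \<open>N dvd A\<close> by simp
      then have "N dvd int i - int s"
        using \<open>coprime B N\<close> by (simp add: coprime_dvd_mult_right_iff coprime_commute)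
      moreover have "\<bar>int i - int s\<bar> < N" "int i - int s \<noteq> 0"
        using i s(1) that assms(4) by auto
      ultimately show False
        using zdvd_not_zless[of "\<bar>int i - int s\<bar>" N] by auto
    qed
    with s(2)[OF i] show ?thesis by linarith
  qed
  with s(1) show thesis
    by (intro that) (auto simp: newton_vertex_def)
qed

section \<open>Dumas' theorem: vertices of products, and widths of edges\<close>

lemma prime_elem_power_dvd_iff:
  fixes p :: "'a::factorial_semiring"
  assumes "prime_elem p" "x \<noteq> 0"
  shows "p ^ n dvd x \<longleftrightarrow> n \<le> multiplicity p x"
  using assms by (intro power_dvd_iff_le_multiplicity) (auto simp: prime_elem_not_unit)

text \<open>As \<open>A > 0\<close>, the bound on a term says that a fixed power of \<open>p\<close>
  divides it, and that power then divides the sum.\<close>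

lemma newton_weight_sum_greater:
  fixes p :: "'a::{factorial_semiring,idom}"
  assumes p: "prime_elem p" and "A > 0"
    and terms: "\<And>i. i \<in> I \<Longrightarrow> x i \<noteq> 0 \<Longrightarrow> c < A * int (multiplicity p (x i))"
    and "sum x I \<noteq> 0"
  shows "c < A * int (multiplicity p (sum x I))"
proof -
  \<comment> \<open>The least natural number \<open>m\<close> with \<open>c < A * m\<close>;
    \<open>nat\<close> turns a negative threshold into 0, which every order meets.\<close>
  define v where "v = nat (c div A + 1)"
  have v: "c < A * int m \<longleftrightarrow> v \<le> m" for m
  proof -
    have "c < A * int m \<longleftrightarrow> c div A < int m"
      using pos_imp_zdiv_neg_iff[OF \<open>A > 0\<close>, of "c + A * - int m"] \<open>A > 0\<close>
      by (subst (asm) div_mult_self2) auto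
    then show ?thesis by (auto simp: v_def)
  qed
  have "p ^ v dvd x i" if "i \<in> I" for i
    using terms[OF that] v prime_elem_power_dvd_iff[OF p] by (cases "x i = 0") auto
  then have "p ^ v dvd sum x I"
    by (rule dvd_sum)
  then show ?thesis
    using v prime_elem_power_dvd_iff[OF p \<open>sum x I \<noteq> 0\<close>] by blast
qed

text \<open>Among all products of a coefficient of \<open>f\<close> and one of \<open>g\<close>, the
  pair \<open>(s, t)\<close> alone has minimal total weight. Nothing can cancel it in coefficient
  \<open>s + t\<close>, and all other coefficients of \<open>f * g\<close> are heavier or
  zero.\<close>

lemma newton_vertex_mult:
  fixes p :: "'a::{factorial_semiring,idom}"
  assumes p: "prime_elem p" and "A > 0"
    and s: "newton_vertex p A B f s" and t: "newton_vertex p A B g t"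
  shows "newton_vertex p A B (f * g) (s + t)"
proof -
  let ?M = "newton_weight p A B f s + newton_weight p A B g t"
  have fs: "coeff f s \<noteq> 0" and gt: "coeff g t \<noteq> 0"
    using s t by (auto simp: newton_vertex_def)
  \<comment> \<open>All products that make up coefficient \<open>n\<close> share the index part
    \<open>B * int n\<close>. Removing it turns a comparison of weights into one of orders, the form
    that passes to sums.\<close>
  have pair: "?M - B * int n < A * int (multiplicity p (coeff f i * coeff g (n - i)))"
    if "i \<le> n" "(i, n - i) \<noteq> (s, t)" "coeff f i * coeff g (n - i) \<noteq> 0" for n i
  proof -
    have nz: "coeff f i \<noteq> 0" "coeff g (n - i) \<noteq> 0"
      using that by auto
    have le: "newton_weight p A B f s \<le> newton_weight p A B f i"
      "newton_weight p A B g t \<le> newton_weight p A B g (n - i)"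
      using newton_vertex_le s t nz by blast+
    have "?M < newton_weight p A B f i + newton_weight p A B g (n - i)"
    proof (cases "i = s")
      case True
      then have "newton_weight p A B g t < newton_weight p A B g (n - i)"
        using that nz t by (auto simp: newton_vertex_def)
      then show ?thesis using le by linarith
    next
      case False
      then have "newton_weight p A B f s < newton_weight p A B f i"
        using nz s by (auto simp: newton_vertex_def)
      then show ?thesis using le by linarith
    qed
    also have "\<dots> = A * int (multiplicity p (coeff f i * coeff g (n - i))) + B * int n"
      using nz p \<open>i \<le> n\<close>
      by (simp add: newton_weight_def prime_elem_multiplicity_mult_distrib of_nat_diff algebra_simps)
    finally show ?thesis by simp
  qed
  have other: "?M < newton_weight p A B (f * g) n"
    if "n \<noteq> s + t" "coeff (f * g) n \<noteq> 0" for n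
  proof -
    have "?M - B * int n < A * int (multiplicity p (\<Sum>i\<le>n. coeff f i * coeff g (n - i)))"
      using that by (intro newton_weight_sum_greater p \<open>A > 0\<close> pair) (auto simp: coeff_mult)
    then show ?thesis by (simp add: newton_weight_def coeff_mult)
  qed
  \<comment> \<open>The rest of coefficient \<open>s + t\<close>. Unless it vanishes, its order
    exceeds that of the main term, so the sum keeps the order of the main term.\<close>
  define r where "r = (\<Sum>i\<in>{..s + t} - {s}. coeff f i * coeff g (s + t - i))"
  have split_r: "coeff (f * g) (s + t) = coeff f s * coeff g t + r"
    by (simp add: coeff_mult r_def sum.remove[of _ s])
  have main: "multiplicity p (coeff f s * coeff g t) = multiplicity p (coeff f s) + multiplicity p (coeff g t)"
    using p fs gt by (rule prime_elem_multiplicity_mult_distrib)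
  have r: "multiplicity p (coeff f s * coeff g t) < multiplicity p r" if "r \<noteq> 0"
  proof -
    have "?M - B * int (s + t) < A * int (multiplicity p r)"
      using that unfolding r_def by (intro newton_weight_sum_greater p \<open>A > 0\<close> pair) auto
    then have "A * int (multiplicity p (coeff f s * coeff g t)) < A * int (multiplicity p r)"
      by (simp add: main newton_weight_def algebra_simps)
    then show ?thesis using \<open>A > 0\<close> by simp
  qed
  have nz: "coeff (f * g) (s + t) \<noteq> 0"
  proof
    assume "coeff (f * g) (s + t) = 0"
    then have "r = - (coeff f s * coeff g t)"
      by (simp add: split_r add_eq_0_iff)
    moreover have "multiplicity p (- x) = multiplicity p x" for x :: 'a
      using multiplicity_times_unit_right[of "- 1" p x] by simp
    ultimately show False using r fs gt by auto
  qed
  have "multiplicity p (coeff (f * g) (s + t)) = multiplicity p (coeff f s * coeff g t)"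
  proof (rule multiplicity_eqI)
    let ?x = "coeff f s * coeff g t"
    have x: "?x \<noteq> 0" using fs gt by simp
    have "p ^ Suc (multiplicity p ?x) dvd r"
      using r prime_elem_power_dvd_iff[OF p] by (cases "r = 0") (auto simp: Suc_le_eq simp del: power_Suc)
    then have "p ^ Suc (multiplicity p ?x) dvd ?x + r \<longleftrightarrow> p ^ Suc (multiplicity p ?x) dvd ?x"
      by (rule dvd_add_left_iff)
    then show "\<not> p ^ Suc (multiplicity p ?x) dvd coeff (f * g) (s + t)"
      using prime_elem_power_dvd_iff[OF p x] by (simp add: split_r del: power_Suc)
    show "p ^ multiplicity p ?x dvd coeff (f * g) (s + t)"
      using \<open>p ^ Suc (multiplicity p ?x) dvd r\<close>
      unfolding split_r by (intro dvd_add multiplicity_dvd) (metis dvd_trans le_imp_power_dvd lessI less_imp_le)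
  qed
  then have "newton_weight p A B (f * g) (s + t) = ?M"
    by (simp add: main newton_weight_def algebra_simps)
  then show ?thesis
    using nz other by (auto simp: newton_vertex_def)
qed

text \<open>Both factors have a vertex for a generic weight; these add up to a vertex of the
  product, which is unique.\<close>

lemma newton_vertex_mult_split:
  fixes p :: "'a::{factorial_semiring,idom}"
  assumes p: "prime_elem p" and "A > 0" and N: "N dvd A" "coprime B N" "int (degree (f * g)) < N"
    and v: "newton_vertex p A B (f * g) s"
  obtains t u where "newton_vertex p A B f t" "newton_vertex p A B g u" "t + u = s"
proof -
  have nz: "f \<noteq> 0" "g \<noteq> 0"
    using v by (auto simp: newton_vertex_def)
  then have "int (degree f) < N" "int (degree g) < N"
    using N(3) by (auto simp: degree_mult_eq)
  then obtain t u where tu: "newton_vertex p A B f t" "newton_vertex p A B g u"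
    using newton_vertex_exists[OF nz(1) N(1,2)] newton_vertex_exists[OF nz(2) N(1,2)] by metis
  moreover have "t + u = s"
    using newton_vertex_mult[OF p \<open>A > 0\<close> tu] v by (rule newton_vertex_unique)
  ultimately show thesis by (rule that)
qed

text \<open>The perturbations by \<open>\<plusminus>1\<close> select the two end points of the edge of slope \<open>- b / m\<close>,
  and the width of an edge is a multiple of the denominator of its slope.\<close>

lemma newton_edge_dvd:
  assumes s: "newton_vertex p (m * N) (b * N + 1) f s"
    and t: "newton_vertex p (m * N) (b * N - 1) f t"
    and N: "int (degree f) < N"
  shows "m dvd b * (int t - int s)"
proof -
  \<comment> \<open>The change of the unperturbed weight \<open>m * order + b * index\<close> from
    \<open>s\<close> to \<open>t\<close>. The two minimality conditions bound
    \<open>\<bar>N * D\<bar>\<close> by \<open>t - s\<close>, which is less than \<open>N\<close>,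
    so \<open>D = 0\<close>.\<close>
  define D where "D = m * (int (multiplicity p (coeff f t)) - int (multiplicity p (coeff f s)))
    + b * (int t - int s)"
  have st: "coeff f s \<noteq> 0" "coeff f t \<noteq> 0"
    using s t by (auto simp: newton_vertex_def)
  have "0 \<le> N * D + (int t - int s)"
    using newton_vertex_le[OF s st(2)] by (simp add: newton_weight_def D_def algebra_simps)
  moreover have "N * D \<le> int t - int s"
    using newton_vertex_le[OF t st(1)] by (simp add: newton_weight_def D_def algebra_simps)
  moreover have "\<bar>int t - int s\<bar> < N"
    using newton_vertex_le_degree[OF s] newton_vertex_le_degree[OF t] N by linarith
  ultimately have "\<bar>N * D\<bar> < N" by linarith
  then have "D = 0"
    using zdvd_not_zless[of "\<bar>N * D\<bar>" N] by (metis abs_mult abs_not_less_zero dvd_abs_iff dvd_triv_left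
        mult_eq_0_iff zero_less_abs_iff)
  then have "b * (int t - int s) = m * (int (multiplicity p (coeff f s)) - int (multiplicity p (coeff f t)))"
    by (simp add: D_def algebra_simps)
  then show ?thesis by simp
qed

text \<open>If \<open>t < s\<close>, a positive index coefficient lets \<open>s\<close> win only by
  a smaller order, while a negative one lets \<open>t\<close> win only by a smaller order; both
  cannot hold.\<close>

lemma newton_vertex_mono:
  assumes s: "newton_vertex p A B f s" and t: "newton_vertex p A' (- B') f t"
    and pos: "A > 0" "A' > 0" "B > 0" "B' > 0"
  shows "s \<le> t"
proof (rule ccontr)
  assume "\<not> s \<le> t"
  then have lt: "int t < int s" by simp
  let ?\<nu> = "\<lambda>i. int (multiplicity p (coeff f i))"
  have st: "coeff f s \<noteq> 0" "coeff f t \<noteq> 0"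
    using s t by (auto simp: newton_vertex_def)
  have "A * ?\<nu> s + B * int s \<le> A * ?\<nu> t + B * int t"
    using newton_vertex_le[OF s st(2)] by (simp add: newton_weight_def)
  moreover have "B * int t < B * int s"
    using lt pos by simp
  ultimately have "A * ?\<nu> s < A * ?\<nu> t" by linarith
  moreover have "A' * ?\<nu> t - B' * int t \<le> A' * ?\<nu> s - B' * int s"
    using newton_vertex_le[OF t st(1)] by (simp add: newton_weight_def)
  moreover have "B' * int t < B' * int s"
    using lt pos by simp
  ultimately have "A * ?\<nu> s < A * ?\<nu> t" "A' * ?\<nu> t < A' * ?\<nu> s" by linarith+
  then show False using pos by simp
qed

section \<open>Factors of a polynomial whose Newton polygon has two edges\<close>

text \<open>The polygon of \<open>f * g\<close> has vertices \<open>(0, d + e)\<close>,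
  \<open>(l, d)\<close>, \<open>(k, d + e)\<close>. Perturbed edge directions pick out the ends of
  each edge, and every such vertex splits between \<open>f\<close> and \<open>g\<close>;
  \<open>t\<close> and \<open>r\<close> are the widths that \<open>f\<close> takes from the left and
  the right edge. The shift \<open>d\<close> leaves room for a constant factor.\<close>

lemma newton_two_edges_factor:
  fixes p :: "'a::{factorial_semiring,idom}" and f g :: "'a poly"
  assumes p: "prime_elem p" and deg: "degree (f * g) = k" and l: "0 < l" "l < k" and e: "0 < e"
    and vl: "coeff (f * g) l \<noteq> 0" "multiplicity p (coeff (f * g) l) = d"
    and v: "\<And>j. j \<le> k \<Longrightarrow> j \<noteq> l \<Longrightarrow>
      coeff (f * g) j \<noteq> 0 \<and> multiplicity p (coeff (f * g) j) = d + e"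
  obtains t r where "degree f = t + r" "t \<le> l" "r \<le> k - l" "l dvd e * t" "k - l dvd e * r"
proof -
  \<comment> \<open>Larger than the degrees of the product and of both factors, so that a
    perturbation by 1 is small against \<open>N\<close>.\<close>
  define N where "N = int k + 1"
  define m where "m = int (k - l)"
  have N: "N > 1" "int (degree (f * g)) < N" and m: "m > 0" "m = int k - int l"
    using l deg by (auto simp: N_def m_def)
  have nz: "f \<noteq> 0" "g \<noteq> 0"
    using vl by auto
  have degs: "degree f + degree g = k"
    using deg nz by (simp add: degree_mult_eq)
  have cop: "coprime (b * N + 1) N" "coprime (b * N - 1) N" for b
    by (intro coprimeI; metis dvd_add_right_iff dvd_diff_right_iff dvd_mult)+
  have jk: "j \<le> k" if "coeff (f * g) j \<noteq> 0" for j
    using that deg le_degree by metis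
  have pos: "int l * N > 0" "m * N > 0"
    using l N m by simp_all
  let ?V = "\<lambda>A B. newton_vertex p (A * N) B"
  have w: "newton_weight p A B (f * g) j = A * (int d + (if j = l then 0 else int e)) + B * int j"
    if "j \<le> k" for A B j
    using v[OF that] vl by (auto simp: newton_weight_def)
  \<comment> \<open>With \<open>C + 1 = e * N\<close> the perturbed index coefficients are
    \<open>C + 2\<close> and \<open>C\<close> up to sign, both visibly positive.\<close>
  define C where "C = int e * N - 1"
  have C: "C > 0"
    using e N unfolding C_def by (smt (verit) mult_le_cancel_right1 of_nat_0_less_iff)
  have C_eqs: "int e * N + 1 = C + 2" "int e * N - 1 = C" "- int e * N + 1 = - C" "- int e * N - 1 = - (C + 2)"
    by (simp_all add: C_def)
  \<comment> \<open>The summand \<open>A * N * d\<close>, common to all weights, is dropped from the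
    comparison.\<close>
  have vertexI: "?V A B (f * g) s"
    if "s \<le> k" and less: "\<And>j. j \<le> k \<Longrightarrow> j \<noteq> s \<Longrightarrow>
        (if s = l then 0 else A * (C + 1)) + B * int s < (if j = l then 0 else A * (C + 1)) + B * int j"
    for A B s
    unfolding newton_vertex_def
  proof (intro conjI allI impI)
    show "coeff (f * g) s \<noteq> 0"
      using v[OF that(1)] vl(1) by (cases "s = l") auto
    have w': "newton_weight p (A * N) B (f * g) j
      = A * N * int d + ((if j = l then 0 else A * (C + 1)) + B * int j)" if "j \<le> k" for j
      using w[OF that, of "A * N" B] by (simp add: C_def algebra_simps)
    show "newton_weight p (A * N) B (f * g) s < newton_weight p (A * N) B (f * g) j"
      if "j \<noteq> s" "coeff (f * g) j \<noteq> 0" for j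
      using less[OF jk[OF that(2)] that(1)] w'[OF \<open>s \<le> k\<close>] w'[OF jk[OF that(2)]] by simp
  qed
  \<comment> \<open>\<open>l * order + e * index\<close> takes its minimum along the left edge; the
    perturbation \<open>+1\<close> selects its end \<open>0\<close>, and \<open>-1\<close> its end
    \<open>l\<close>.\<close>
  have V0: "?V (int l) (int e * N + 1) (f * g) 0"
    unfolding C_eqs
  proof (rule vertexI)
    fix j :: nat assume "j \<noteq> 0"
    then have "C * int j > 0" using C by simp
    then show "(if 0 = l then 0 else int l * (C + 1)) + (C + 2) * int 0
      < (if j = l then 0 else int l * (C + 1)) + (C + 2) * int j"
      using l by (auto simp: algebra_simps)
  qed simp
  have V1: "?V (int l) (int e * N - 1) (f * g) l"
    unfolding C_eqs
  proof (rule vertexI)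
    fix j assume "j \<noteq> l"
    have "C * int j \<ge> 0" using C by simp
    with \<open>j \<noteq> l\<close> show "(if l = l then 0 else int l * (C + 1)) + C * int l
      < (if j = l then 0 else int l * (C + 1)) + C * int j"
      using l by (auto simp: algebra_simps)
  qed (use l in simp)
  \<comment> \<open>Likewise for the right edge, of slope \<open>e / m\<close>, with ends
    \<open>l\<close> and \<open>k\<close>.\<close>
  have V2: "?V m (- int e * N + 1) (f * g) l"
    unfolding C_eqs
  proof (rule vertexI)
    fix j assume "j \<noteq> l" "j \<le> k"
    then have "C * int j \<le> C * (int l + m)" using C m by (intro mult_left_mono) auto
    with \<open>j \<noteq> l\<close> show "(if l = l then 0 else m * (C + 1)) + - C * int l
      < (if j = l then 0 else m * (C + 1)) + - C * int j"
      using l m(1) by (auto simp: algebra_simps)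
  qed (use l in simp)
  have V3: "?V m (- int e * N - 1) (f * g) k"
    unfolding C_eqs
  proof (rule vertexI)
    fix j assume "j \<noteq> k" "j \<le> k"
    then have "(C + 2) * int j < (C + 2) * int k" using C by (intro mult_strict_left_mono) auto
    moreover have "(C + 2) * int k = (C + 2) * int l + (C + 2) * m"
      unfolding m(2) by (simp add: algebra_simps)
    moreover have "(C + 2) * m = m * (C + 1) + m" by (simp add: algebra_simps)
    ultimately show "(if k = l then 0 else m * (C + 1)) + - (C + 2) * int k
      < (if j = l then 0 else m * (C + 1)) + - (C + 2) * int j"
      using l m(1) unfolding mult_minus_left by (cases "j = l") auto
  qed simp
  note split = newton_vertex_mult_split[OF p _ _ cop(1) N(2)] newton_vertex_mult_split[OF p _ _ cop(2) N(2)]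
  obtain s0 s0' where 0: "?V (int l) (int e * N + 1) f s0" "?V (int l) (int e * N + 1) g s0'" "s0 + s0' = 0"
    using split(1)[OF pos(1) _ V0] by auto
  obtain t t' where 1: "?V (int l) (int e * N - 1) f t" "?V (int l) (int e * N - 1) g t'" "t + t' = l"
    using split(2)[OF pos(1) _ V1] by auto
  obtain s s' where 2: "?V m (- int e * N + 1) f s" "?V m (- int e * N + 1) g s'" "s + s' = l"
    using split(1)[OF pos(2) _ V2] by auto
  obtain u u' where 3: "?V m (- int e * N - 1) f u" "?V m (- int e * N - 1) g u'" "u + u' = k"
    using split(2)[OF pos(2) _ V3] by auto
  \<comment> \<open>The vertex \<open>l\<close> is reached from both edges. Monotonicity in each
    factor and the equal sums \<open>t + t' = s + s'\<close> make the two splittings agree.\<close>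
  have "t \<le> s" "t' \<le> s'"
    using newton_vertex_mono[OF 1(1)[unfolded C_eqs] 2(1)[unfolded C_eqs] pos C C]
      newton_vertex_mono[OF 1(2)[unfolded C_eqs] 2(2)[unfolded C_eqs] pos C C] by auto
  with 1(3) 2(3) have s: "s = t" by linarith
  have "t \<le> l" "s0 = 0" using 0(3) 1(3) by auto
  have u: "u = degree f" "u' = degree g"
    using newton_vertex_le_degree[OF 3(1)] newton_vertex_le_degree[OF 3(2)] 3(3) degs by auto
  have "u' \<ge> s'"
    using newton_vertex_le_degree[OF 2(2)] u by simp
  have "t \<le> u"
    using newton_vertex_le_degree[OF 1(1)] u by simp
  have df: "int (degree f) < N"
    using degs by (simp add: N_def)
  have "int l dvd int e * int t"
    using newton_edge_dvd[OF 0(1) 1(1) df] \<open>s0 = 0\<close> by simp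
  then have "l dvd e * t"
    by (metis int_dvd_int_iff of_nat_mult)
  moreover have "m dvd int e * (int u - int t)"
    using newton_edge_dvd[OF 2(1) 3(1) df] s by simp
  then have "int (k - l) dvd int (e * (u - t))"
    using \<open>t \<le> u\<close> by (simp add: m_def of_nat_diff)
  then have "k - l dvd e * (u - t)"
    by (simp only: int_dvd_int_iff)
  \<comment> \<open>The right edge of \<open>g\<close> has width \<open>u' - s' \<ge> 0\<close>, and
    the two widths add up to \<open>k - l\<close>.\<close>
  moreover have "u - t \<le> k - l"
    using 1(3) 2(3) 3(3) s \<open>u' \<ge> s'\<close> by linarith
  ultimately show thesis
    using that[of t "u - t"] u \<open>t \<le> u\<close> \<open>t \<le> l\<close> by simp
qed

section \<open>From rational to integer factors\<close>

lemma map_poly_of_int_mult: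
  "map_poly (of_int :: int \<Rightarrow> 'a::comm_ring_1) (f * g) = map_poly of_int f * map_poly of_int g"
  by (rule poly_eqI) (simp add: coeff_map_poly coeff_mult)

lemma rat_poly_clear_denominators:
  fixes f :: "rat poly"
  obtains d g where "d \<noteq> 0" "smult (of_int d) f = map_poly of_int g"
proof -
  have "\<exists>d g. d \<noteq> 0 \<and> smult (of_int d) f = map_poly of_int g"
  proof (induction f)
    case 0
    show ?case by (intro exI[of _ 1] exI[of _ 0]) simp
  next
    case (pCons c f)
    then obtain d g where dg: "d \<noteq> 0" "smult (of_int d) f = map_poly of_int g"
      by blast
    obtain x y where xy: "quotient_of c = (x, y)" by force
    then have "y > 0" "c = of_int x / of_int y"
      by (auto intro: quotient_of_denom_pos quotient_of_div)
    then have "smult (of_int (y * d)) (pCons c f) = map_poly of_int (pCons (x * d) (smult y g))"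
      using dg by (auto simp: map_poly_pCons map_poly_smult simp flip: smult_smult)
    moreover have "y * d \<noteq> 0" using dg \<open>y > 0\<close> by simp
    ultimately show ?case by blast
  qed
  then show thesis using that by blast
qed

text \<open>Clearing the denominators of both factors leaves a constant \<open>d\<close>. It shifts
  the orders of all non-zero coefficients of \<open>F\<close> equally, so the shape of the Newton
  polygon survives.\<close>

lemma rat_poly_dvd_of_int_poly:
  fixes g :: "rat poly" and F :: "int poly"
  assumes "g dvd map_poly of_int F"
  obtains d G H where "d \<noteq> 0" "smult d F = G * H" "degree G = degree g"
proof -
  from assms obtain h where h: "map_poly of_int F = g * h" by blast
  obtain x G where G: "x \<noteq> 0" "smult (of_int x) g = map_poly of_int G"
    by (rule rat_poly_clear_denominators)
  obtain y H where H: "y \<noteq> 0" "smult (of_int y) h = map_poly of_int H"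
    by (rule rat_poly_clear_denominators)
  have "map_poly rat_of_int (smult (x * y) F) = smult (of_int x * of_int y) (g * h)"
    by (simp add: map_poly_smult h)
  also have "\<dots> = smult (of_int x) g * smult (of_int y) h"
    by (simp add: mult.commute)
  also have "\<dots> = map_poly of_int (G * H)"
    by (simp add: G H map_poly_of_int_mult)
  finally have "smult (x * y) F = G * H"
    by (simp add: poly_eq_iff coeff_map_poly del: coeff_smult)
  moreover have "degree G = degree g"
    using G by (metis degree_map_poly degree_smult_eq of_int_eq_0_iff)
  ultimately show thesis
    using that[of "x * y" G H] G H by simp
qed

section \<open>The \<open>p\<close>-adic orders of the binomial coefficients
  \<open>coeff_c\<close>\<close>

lemma multiplicity_of_nat_int:
  "multiplicity (int p) (int x) = multiplicity p x"
proof -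
  have "int p ^ r dvd int x \<longleftrightarrow> p ^ r dvd x" for r
    by (simp flip: of_nat_power)
  then show ?thesis
    by (simp add: multiplicity_def)
qed

lemma fact_eq_prod_diff:
  assumes "k < n"
  shows "(fact n :: nat) = fact (n - k - 1) * (\<Prod>i\<le>k. n - i)"
  using assms
proof (induction k)
  case 0
  then show ?case by (cases n) (simp_all add: algebra_simps)
next
  case (Suc k)
  have "(fact (n - k - 1) :: nat) = (n - Suc k) * fact (n - Suc k - 1)"
    using Suc.prems fact_reduce[of "n - Suc k", where ?'a = nat] by simp
  then show ?case using Suc by (simp add: algebra_simps)
qed

text \<open>Up to sign, \<open>coeff_c n k j\<close> is \<open>n (n - 1) ... (n - k)\<close> divided
  by \<open>j! (k - j)! (n - j)\<close>, from which orders can be read off.\<close>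

lemma choose_choose_fact:
  assumes "j \<le> k" "k < n"
  shows "(n choose j) * ((n - j - 1) choose (k - j)) * (fact j * fact (k - j)) * (n - j) = (\<Prod>i\<le>k. n - i)"
proof -
  have 1: "fact j * fact (n - j) * (n choose j) = fact n"
    using assms by (intro binomial_fact_lemma) simp
  have 2: "fact (k - j) * fact (n - k - 1) * ((n - j - 1) choose (k - j)) = fact (n - j - 1)"
    using assms binomial_fact_lemma[of "k - j" "n - j - 1"] by simp
  have 3: "(fact (n - j) :: nat) = (n - j) * fact (n - j - 1)"
    using assms fact_reduce[of "n - j", where ?'a = nat] by simp
  have "fact (n - k - 1) * ((n choose j) * ((n - j - 1) choose (k - j)) * (fact j * fact (k - j)) * (n - j)) = fact n"
    by (simp only: 1[symmetric] 2[symmetric] 3 mult_ac)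
  also have "\<dots> = fact (n - k - 1) * (\<Prod>i\<le>k. n - i)"
    using assms by (intro fact_eq_prod_diff) simp
  finally show ?thesis by simp
qed

text \<open>Two multiples of \<open>p\<close> among \<open>n, ..., n - k\<close> differ by at most
  \<open>k < p\<close>, so they coincide.\<close>

lemma multiplicity_prod_diff:
  fixes p :: nat
  assumes "prime p" "p > k" "l \<le> k" "k < n" "p dvd n - l"
  shows "multiplicity p (\<Prod>i\<le>k. n - i) = multiplicity p (n - l)"
    and "j \<le> k \<Longrightarrow> j \<noteq> l \<Longrightarrow> multiplicity p (n - j) = 0"
proof -
  show *: "multiplicity p (n - j) = 0" if "j \<le> k" "j \<noteq> l" for j
  proof (rule not_dvd_imp_multiplicity_0, rule notI)
    assume "p dvd n - j"
    then have "int p dvd int (n - j) - int (n - l)"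
      using assms(5) by (intro dvd_diff) (simp_all only: int_dvd_int_iff)
    then have "int p dvd int l - int j"
      using that assms by (simp add: of_nat_diff)
    moreover have "int l - int j \<noteq> 0" "\<bar>int l - int j\<bar> < int p"
      using that assms by auto
    ultimately show False
      using zdvd_not_zless[of "\<bar>int l - int j\<bar>" "int p"] by auto
  qed
  have "multiplicity p (\<Prod>i\<le>k. n - i) = (\<Sum>i\<le>k. multiplicity p (n - i))"
    using assms by (intro prime_elem_multiplicity_prod_distrib) auto
  also have "\<dots> = multiplicity p (n - l)"
    using assms * by (subst sum.remove[of _ l]) auto
  finally show "multiplicity p (\<Prod>i\<le>k. n - i) = multiplicity p (n - l)" .
qed

lemma coeff_c_nonzero:
  assumes "j \<le> k" "k < n"
  shows "coeff_c n k j \<noteq> 0"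
  using assms by (auto simp: coeff_c_def)

text \<open>In \<open>choose_choose_fact\<close> the factorials are prime to \<open>p\<close>
  because \<open>p > k\<close>. The product has the order of \<open>n - l\<close>, and the factor
  \<open>n - j\<close> absorbs all of it if \<open>j = l\<close> and none otherwise.\<close>

lemma multiplicity_coeff_c:
  fixes p :: nat
  assumes "prime p" "p > k" "l \<le> k" "k < n" "p dvd n - l" "j \<le> k"
  shows "multiplicity (int p) (coeff_c n k j) = (if j = l then 0 else multiplicity p (n - l))"
proof -
  let ?c = "(n choose j) * ((n - j - 1) choose (k - j))"
  have c: "?c \<noteq> 0" using assms by auto
  have f: "multiplicity p (fact j * fact (k - j)) = 0"
    using assms by (intro not_dvd_imp_multiplicity_0) (auto simp: prime_dvd_mult_iff prime_dvd_fact_iff)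
  have "multiplicity p (n - l) = multiplicity p (?c * (fact j * fact (k - j)) * (n - j))"
    using assms by (simp only: choose_choose_fact multiplicity_prod_diff)
  also have "\<dots> = multiplicity p (?c * (fact j * fact (k - j))) + multiplicity p (n - j)"
    using assms c by (intro prime_elem_multiplicity_mult_distrib) auto
  also have "multiplicity p (?c * (fact j * fact (k - j))) = multiplicity p ?c"
    using assms c f by (subst prime_elem_multiplicity_mult_distrib) auto
  finally have "multiplicity p ?c = (if j = l then 0 else multiplicity p (n - l))"
    using multiplicity_prod_diff(2)[OF assms(1-5), of j] assms(6) by auto
  moreover have "multiplicity (int p) (int ?c) = multiplicity p ?c"
    by (rule multiplicity_of_nat_int)
  moreover have "coeff_c n k j = int ?c * (- 1) ^ (k - j)"
    by (simp add: coeff_c_def)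
  then have "multiplicity (int p) (coeff_c n k j) = multiplicity (int p) (int ?c)"
    using multiplicity_times_unit_right[of "(- 1) ^ (k - j)" "int p" "int ?c"] by (simp add: mult.commute)
  ultimately show ?thesis by simp
qed

section \<open>Coefficients of \<open>poly_F\<close>, the gcd conditions, and the conclusion\<close>

lemma coeff_poly_F: "coeff (poly_F a n k) j = (if j \<le> k then a j * coeff_c n k j else 0)"
  by (auto simp: poly_F_def coeff_sum)

text \<open>\<open>l\<close> divides \<open>e * t\<close> and \<open>l * t\<close>, hence
  \<open>gcd e l * t\<close> and so \<open>2 * t\<close>; as \<open>t \<le> l\<close>, the quotient
  is 0, 1 or 2.\<close>

lemma dvd_mult_gcd_le_2_cases:
  fixes e l t :: nat
  assumes "l dvd e * t" "gcd e l \<le> 2" "l > 0" "t \<le> l"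
  shows "t = 0 \<or> 2 * t = l \<or> t = l"
proof -
  have "l dvd gcd (e * t) (l * t)"
    using assms by simp
  then have "l dvd gcd e l * t"
    by (simp add: gcd_mult_distrib_nat mult.commute)
  moreover have "gcd e l = 1 \<or> gcd e l = 2"
    using assms by (metis One_nat_def Suc_1 gcd_eq_0_iff le_SucE le_zero_eq not_gr_zero)
  ultimately have "l dvd 2 * t" by auto
  then obtain c where c: "2 * t = l * c" by blast
  then have "l * c \<le> l * 2" using assms(4) by linarith
  then have "c \<le> 2" using \<open>l > 0\<close> by (simp only: mult_le_cancel1)
  then have "c = 0 \<or> c = 1 \<or> c = 2" by auto
  with c show ?thesis using assms by auto
qed

theorem theorem1p3:
  fixes n k l l1 p e :: nat and a :: "nat \<Rightarrow> int"
  assumes "n \<ge> k + 2" and "k + 2 \<ge> 4"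
    and "\<And>j. j \<le> k \<Longrightarrow> a j \<noteq> 0"
    and "\<And>j q. j \<le> k \<Longrightarrow> q \<in> prime_factors (a j) \<Longrightarrow> q \<le> int k"
    and "prime p" and "p > k"
    and "1 \<le> l" and "l \<le> k - 1"
    and "p dvd n - l"
    and "e = multiplicity p (n - l)"
    and "gcd e l \<le> 2" and "gcd e (k - l) \<le> 2"
    and "l1 > 0" and "real l1 < real k / 2"
    and "l \<notin> {l1, 2 * l1, k - l1, k - 2 * l1}"
  shows "\<not> (\<exists>g :: rat poly. degree g = l1 \<and> g dvd map_poly of_int (poly_F a n k))"
proof
  assume "\<exists>g :: rat poly. degree g = l1 \<and> g dvd map_poly of_int (poly_F a n k)"
  then obtain g :: "rat poly" where g: "degree g = l1" "g dvd map_poly of_int (poly_F a n k)"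
    by blast
  from g(2) obtain d G H where G: "d \<noteq> 0" "smult d (poly_F a n k) = G * H" "degree G = degree g"
    by (rule rat_poly_dvd_of_int_poly)
  have l: "0 < l" "l < k" "l \<le> k" and kn: "k < n" and nl: "n - l \<noteq> 0"
    using assms(1,2,7,8) by auto
  have p: "prime_elem (int p)"
    using \<open>prime p\<close> by auto
  \<comment> \<open>All prime factors of \<open>a j\<close> are at most \<open>k < p\<close>, so the
    \<open>a j\<close> do not affect the orders.\<close>
  have a: "multiplicity (int p) (a j) = 0" if "j \<le> k" for j
  proof (rule not_dvd_imp_multiplicity_0, rule notI)
    assume "int p dvd a j"
    then have "int p \<in> prime_factors (a j)"
      using assms(3)[OF that] \<open>prime p\<close> by (auto simp: prime_factors_dvd)
    from assms(4)[OF that this] show False using \<open>p > k\<close> by simp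
  qed
  have coeff: "coeff (G * H) j \<noteq> 0 \<and>
      multiplicity (int p) (coeff (G * H) j) = multiplicity (int p) d + (if j = l then 0 else e)"
    if "j \<le> k" for j
    using that G(1) assms(3)[OF that] coeff_c_nonzero[OF that kn] p a[OF that]
      multiplicity_coeff_c[OF assms(5,6) l(3) kn assms(9) that]
    by (simp add: G(2)[symmetric] coeff_poly_F prime_elem_multiplicity_mult_distrib \<open>e = _\<close>)
  have deg: "degree (G * H) = k"
  proof (rule antisym)
    show "degree (G * H) \<le> k"
      by (rule degree_le) (simp add: G(2)[symmetric] coeff_poly_F)
    show "k \<le> degree (G * H)"
      using coeff[of k] by (intro le_degree) simp
  qed
  have "e > 0"
    using assms(5,9,10) nl by (simp add: prime_multiplicity_gt_zero_iff)
  obtain t r where tr: "degree G = t + r" "t \<le> l" "r \<le> k - l" "l dvd e * t" "k - l dvd e * r"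
    by (rule newton_two_edges_factor[OF p deg l(1,2) \<open>e > 0\<close>, of "multiplicity (int p) d"])
      (use coeff l in auto)
  have "t = 0 \<or> 2 * t = l \<or> t = l"
    using dvd_mult_gcd_le_2_cases[OF tr(4) assms(11) l(1) tr(2)] .
  moreover have "r = 0 \<or> 2 * r = k - l \<or> r = k - l"
    using dvd_mult_gcd_le_2_cases[OF tr(5) assms(12) _ tr(3)] l by simp
  moreover have "l1 = t + r" "2 * l1 < k"
    using tr(1) g(1) G(3) assms(14) by linarith+
  \<comment> \<open>\<open>t = r = 0\<close> contradicts \<open>l1 > 0\<close>. If both are
    non-zero, then \<open>2 * l1 \<ge> l + (k - l) = k\<close>. With \<open>r = 0\<close>,
    \<open>l\<close> is \<open>2 * l1\<close> or \<open>l1\<close>; with \<open>t = 0\<close>, it is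
    \<open>k - 2 * l1\<close> or \<open>k - l1\<close>.\<close>
  ultimately show False
    using assms(13,15) l by auto
qed

end
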